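(* The following are equivalent: (i) the Continuum Hypothesis $\aleph_1 = 2^{\aleph_0}$ holds; (ii) there exists a subsemigroup $S$ of $\mathbb{N}^\mathbb{N}$ such that $S \approx \mathbb{N}^\mathbb{N}$ and for every subsemigroup $T$ of $S$, either $T \approx \mathbb{N}^\mathbb{N}$ or $T \approx \{1_{\mathbb{N}}\}$.
   Context: $\mathbb{N}=\{0,1,2,\ldots\}$ and $\mathbb{N}^\mathbb{N}$ is the semigroup of all maps $\mathbb{N}\to\mathbb{N}$ under composition; $1_{\mathbb{N}}$ is the identity map. For $V\subseteq \mathbb{N}^\mathbb{N}$ and $C\subseteq\mathbb{N}^\mathbb{N}$, $\langle V, C\rangle$ denotes the subsemigroup of $\mathbb{N}^\mathbb{N}$ generated by $V\cup C$. For subsets $U,V\subseteq\mathbb{N}^\mathbb{N}$, write $U\preccurlyeq V$ if there is a countable $C\subseteq \mathbb{N}^\mathbb{N}$ with $U\subseteq\langle V, C\rangle$; write $U\approx V$ if $U\preccurlyeq V$ and $V\preccurlyeq U$. *)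

theory Defs
  imports Complex_Main "HOL-Library.Countable_Set"
begin

unbundle cardinal_syntax

text \<open>\<open>cardSuc natLeq\<close> is $\aleph_1$ and \<open>ctwo ^c natLeq\<close> is $2^{\aleph_0}$.\<close>

definition continuum_hypothesis :: bool where
  "continuum_hypothesis \<longleftrightarrow> cardSuc natLeq =o ctwo ^c natLeq"

text \<open>The empty set is admitted as a subsemigroup.\<close>

definition subsemigroup :: "(nat \<Rightarrow> nat) set \<Rightarrow> bool" where
  "subsemigroup S \<longleftrightarrow> (\<forall>f\<in>S. \<forall>g\<in>S. f \<circ> g \<in> S)"

definition generated :: "(nat \<Rightarrow> nat) set \<Rightarrow> (nat \<Rightarrow> nat) set \<Rightarrow> (nat \<Rightarrow> nat) set" where
  "generated V C = subsemigroup hull (V \<union> C)"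

definition gen_le :: "(nat \<Rightarrow> nat) set \<Rightarrow> (nat \<Rightarrow> nat) set \<Rightarrow> bool"  (infix \<open>\<preceq>\<^sub>\<omega>\<close> 50) where
  "U \<preceq>\<^sub>\<omega> V \<longleftrightarrow> (\<exists>C. countable C \<and> U \<subseteq> generated V C)"

definition gen_equiv :: "(nat \<Rightarrow> nat) set \<Rightarrow> (nat \<Rightarrow> nat) set \<Rightarrow> bool"  (infix \<open>\<approx>\<^sub>\<omega>\<close> 50) where
  "U \<approx>\<^sub>\<omega> V \<longleftrightarrow> U \<preceq>\<^sub>\<omega> V \<and> V \<preceq>\<^sub>\<omega> U"

end

theory Submission
  imports Defs "HOL-Library.Countable_Set_Type"
begin

text \<open>
  A set is \<open>\<approx>\<^sub>\<omega> {id}\<close> exactly when it is countable. Given \<open>S\<close> as in (ii), a subset of \<open>S\<close> of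
  size \<open>\<aleph>\<^sub>1\<close> generates a subsemigroup of size \<open>\<aleph>\<^sub>1\<close>, which must then generate all maps modulo a
  countable set; hence the continuum is at most \<open>\<aleph>\<^sub>1\<close>.

  Conversely, CH well-orders the maps in such a way that every initial segment is countable.
  Enumerating the initial segments gives a family of sequences of maps such that each map is
  missed by only countably many of them. Encode a sequence as a single map that vanishes on even
  numbers, takes even values, and stores the sequence on the odd numbers. Any two such encodings
  compose to the zero map, so together with the zero map they form a semigroup \<open>S\<close>. An uncountable
  subset of \<open>S\<close> encodes, for every map \<open>g\<close>, some sequence containing \<open>g\<close>, and countably many
  fixed maps suffice to decode.
\<close>

lemma cexp_ordIso_ctwo_cexp:
  assumes r: "Cinfinite r" and s: "ctwo \<le>o s" "s \<le>o ctwo ^c r"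
  shows "s ^c r =o ctwo ^c r"
  unfolding ordIso_iff_ordLeq
proof
  have "s ^c r \<le>o (ctwo ^c r) ^c r"
    using s(2) r by (intro cexp_mono1) simp_all
  also have "(ctwo ^c r) ^c r =o ctwo ^c r"
    using r by (intro cexp_cprod_ordLeq Card_order_ctwo Cinfinite_Cnotzero ordLeq_refl) simp_all
  finally show "s ^c r \<le>o ctwo ^c r" .
  show "ctwo ^c r \<le>o s ^c r"
    using s(1) r by (intro cexp_mono1) simp_all
qed

lemma card_of_nat_fun: "|UNIV :: (nat \<Rightarrow> nat) set| =o ctwo ^c natLeq"
proof -
  have "|UNIV :: (nat \<Rightarrow> nat) set| =o |Func (UNIV :: nat set) (UNIV :: nat set)|"
    using ordIso_symmetric[OF card_of_Func_UNIV[of "UNIV :: nat set"]] by simp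
  also have "|Func (UNIV :: nat set) (UNIV :: nat set)| = natLeq ^c natLeq"
    by (simp add: cexp_def Field_natLeq)
  also have "natLeq ^c natLeq =o ctwo ^c natLeq"
    by (intro cexp_ordIso_ctwo_cexp natLeq_Cinfinite ctwo_ordLeq_Cinfinite
        ordLess_imp_ordLeq ordLess_ctwo_cexp natLeq_Card_order)
  finally show ?thesis .
qed

lemma continuum_hypothesis_iff_card_of_nat_fun:
  "continuum_hypothesis \<longleftrightarrow> |UNIV :: (nat \<Rightarrow> nat) set| \<le>o cardSuc natLeq"
proof -
  have "cardSuc natLeq \<le>o ctwo ^c natLeq"
    by (intro cardSuc_least natLeq_Card_order Card_order_cexp ordLess_ctwo_cexp)
  then have "continuum_hypothesis \<longleftrightarrow> ctwo ^c natLeq \<le>o cardSuc natLeq"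
    by (simp add: continuum_hypothesis_def ordIso_iff_ordLeq)
  also have "\<dots> \<longleftrightarrow> |UNIV :: (nat \<Rightarrow> nat) set| \<le>o cardSuc natLeq"
    using ordIso_ordLeq_trans[OF card_of_nat_fun]
      ordIso_ordLeq_trans[OF ordIso_symmetric[OF card_of_nat_fun]] by blast
  finally show ?thesis .
qed

lemma uncountable_nat_fun: "uncountable (UNIV :: (nat \<Rightarrow> nat) set)"
  unfolding countable_card_le_natLeq
  using ordLess_ctwo_cexp[OF natLeq_Card_order] ordIso_symmetric[OF card_of_nat_fun]
  by (blast dest: ordLess_ordIso_trans not_ordLess_ordLeq)

lemma uncountable_iff_cardSuc_natLeq_ordLeq: "uncountable A \<longleftrightarrow> cardSuc natLeq \<le>o |A|"
  unfolding countable_card_le_natLeq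
  by (simp add: not_ordLeq_iff_ordLess natLeq_Well_order card_of_Well_order
      cardSuc_ordLess_ordLeq natLeq_Card_order card_of_Card_order)

lemma ordLeq_card_of_obtain_subset:
  assumes "Card_order r" "r \<le>o |A|"
  obtains B where "B \<subseteq> A" "|B| =o r"
proof -
  have r: "|Field r| =o r"
    using assms(1) by (rule card_of_Field_ordIso)
  with assms(2) have "|Field r| \<le>o |A|"
    by (blast intro: ordIso_ordLeq_trans)
  then obtain B where B: "B \<subseteq> A" "|Field r| =o |B|"
    unfolding internalize_card_of_ordLeq2[of "Field r" A] by blast
  show thesis
    using B(1) ordIso_transitive[OF ordIso_symmetric[OF B(2)] r] by (rule that)
qed

lemma countable_ordLeq_Cinfinite: "countable A \<Longrightarrow> Cinfinite r \<Longrightarrow> |A| \<le>o r"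
  unfolding countable_card_le_natLeq
  by (blast intro: ordLeq_transitive natLeq_ordLeq_cinfinite)

lemma card_of_lists_ordLeq_Cinfinite:
  assumes A: "|A| \<le>o r" and r: "Cinfinite r"
  shows "|lists A| \<le>o r"
proof -
  have "|{xs. set xs \<subseteq> A \<and> length xs = n}| \<le>o r" for n
  proof (induction n)
    case 0
    have "{xs. set xs \<subseteq> A \<and> length xs = 0} = {[]}"
      by auto
    with r show ?case
      by (simp add: countable_ordLeq_Cinfinite)
  next
    case (Suc n)
    with A r have "|{xs. set xs \<subseteq> A \<and> length xs = n} \<times> A| \<le>o r"
      by (auto simp: cinfinite_def intro: card_of_Times_ordLeq_infinite_Field)
    then show ?case
      unfolding lists_length_Suc_eq by (rule ordLeq_transitive[OF card_of_image])
  qed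
  then have "|\<Union>n. {xs. set xs \<subseteq> A \<and> length xs = n}| \<le>o r"
    using r by (intro UNION_Cinfinite_bound countable_ordLeq_Cinfinite) simp_all
  also have "(\<Union>n. {xs. set xs \<subseteq> A \<and> length xs = n}) = lists A"
    by auto
  finally show ?thesis .
qed

text \<open>Composing a list of maps is \<open>foldr id\<close>, as \<open>foldr id (f # fs) = f \<circ> foldr id fs\<close>.\<close>

lemma subsemigroup_hull_subset_foldr: "subsemigroup hull A \<subseteq> foldr id ` lists A"
proof (rule hull_minimal)
  show "A \<subseteq> foldr id ` lists A"
  proof
    fix f assume "f \<in> A"
    then have "[f] \<in> lists A" "f = foldr id [f]"
      by simp_all
    then show "f \<in> foldr id ` lists A"
      by blast
  qed
  have "foldr id fs \<circ> foldr id gs = foldr id (fs @ gs)" for fs gs :: "(nat \<Rightarrow> nat) list"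
    by (simp add: fun_eq_iff)
  then show "subsemigroup (foldr id ` lists A)"
    unfolding subsemigroup_def by (auto intro!: imageI)
qed

lemma card_of_subsemigroup_hull_ordLeq:
  assumes "|A| \<le>o r" "Cinfinite r"
  shows "|subsemigroup hull A| \<le>o r"
proof -
  have "|subsemigroup hull A| \<le>o |foldr id ` lists A|"
    by (rule card_of_mono1[OF subsemigroup_hull_subset_foldr])
  also have "|foldr id ` lists A| \<le>o |lists A|"
    by (rule card_of_image)
  also have "|lists A| \<le>o r"
    using assms by (rule card_of_lists_ordLeq_Cinfinite)
  finally show ?thesis .
qed

lemma subsemigroup_hull: "subsemigroup (subsemigroup hull A)"
  by (rule hull_in) (auto simp: subsemigroup_def)

lemma comp_in_generated: "f \<in> generated V C \<Longrightarrow> g \<in> generated V C \<Longrightarrow> f \<circ> g \<in> generated V C"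
  using subsemigroup_hull unfolding generated_def subsemigroup_def by blast

lemma subset_generated: "V \<union> C \<subseteq> generated V C"
  unfolding generated_def by (rule hull_subset)

lemma subset_imp_gen_le: "U \<subseteq> V \<Longrightarrow> U \<preceq>\<^sub>\<omega> V"
  unfolding gen_le_def using subset_generated[of V "{}"] by (intro exI[of _ "{}"]) auto

lemma countable_imp_gen_le: "countable U \<Longrightarrow> U \<preceq>\<^sub>\<omega> V"
  unfolding gen_le_def using subset_generated[of V U] by blast

lemma gen_le_imp_card_of_ordLeq:
  assumes "U \<preceq>\<^sub>\<omega> V" and V: "|V| \<le>o r" and r: "Cinfinite r"
  shows "|U| \<le>o r"
proof -
  obtain C where C: "countable C" "U \<subseteq> generated V C"
    using assms(1) by (auto simp: gen_le_def)
  have "|V \<union> C| \<le>o r"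
    using V countable_ordLeq_Cinfinite[OF C(1) r] r by (rule Un_Cinfinite_bound)
  then have "|generated V C| \<le>o r"
    unfolding generated_def using r by (rule card_of_subsemigroup_hull_ordLeq)
  with C(2) show ?thesis
    by (blast intro: card_of_mono1 ordLeq_transitive)
qed

lemma gen_le_countable: "U \<preceq>\<^sub>\<omega> V \<Longrightarrow> countable V \<Longrightarrow> countable U"
  unfolding countable_card_le_natLeq by (rule gen_le_imp_card_of_ordLeq[OF _ _ natLeq_Cinfinite])

lemma gen_equiv_id_iff_countable: "T \<approx>\<^sub>\<omega> {id} \<longleftrightarrow> countable T"
  unfolding gen_equiv_def by (auto intro: countable_imp_gen_le gen_le_countable)

lemma gen_equiv_UNIV_iff: "T \<approx>\<^sub>\<omega> UNIV \<longleftrightarrow> UNIV \<preceq>\<^sub>\<omega> T"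
  unfolding gen_equiv_def by (simp add: subset_imp_gen_le)

lemma continuum_hypothesis_if_dichotomy:
  assumes S: "subsemigroup S" "S \<approx>\<^sub>\<omega> UNIV"
    and dichotomy: "\<And>T. T \<subseteq> S \<Longrightarrow> subsemigroup T \<Longrightarrow> T \<approx>\<^sub>\<omega> UNIV \<or> T \<approx>\<^sub>\<omega> {id}"
  shows continuum_hypothesis
proof -
  have aleph1: "Cinfinite (cardSuc natLeq)"
    by (intro Cinfinite_cardSuc natLeq_Cinfinite)
  have "uncountable S"
    using S(2) uncountable_nat_fun by (auto simp: gen_equiv_UNIV_iff dest: gen_le_countable)
  then obtain A where A: "A \<subseteq> S" "|A| =o cardSuc natLeq"
    using aleph1 ordLeq_card_of_obtain_subset
    unfolding uncountable_iff_cardSuc_natLeq_ordLeq by blast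
  define T where "T = subsemigroup hull A"
  have "A \<subseteq> T"
    unfolding T_def by (rule hull_subset)
  moreover have "uncountable A"
    using A(2) by (simp add: uncountable_iff_cardSuc_natLeq_ordLeq ordIso_iff_ordLeq)
  ultimately have "uncountable T"
    using countable_subset by blast
  moreover have "T \<subseteq> S" "subsemigroup T"
    using A(1) S(1) by (simp_all add: T_def hull_minimal subsemigroup_hull)
  ultimately have "UNIV \<preceq>\<^sub>\<omega> T"
    using dichotomy by (auto simp: gen_equiv_UNIV_iff gen_equiv_id_iff_countable)
  moreover have "|T| \<le>o cardSuc natLeq"
    unfolding T_def using A(2) aleph1
    by (intro card_of_subsemigroup_hull_ordLeq ordIso_imp_ordLeq)
  ultimately show ?thesis
    unfolding continuum_hypothesis_iff_card_of_nat_fun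
    using aleph1 by (rule gen_le_imp_card_of_ordLeq)
qed

lemma ordLeq_cardSuc_natLeq_obtain_enumeration:
  assumes "|UNIV :: 'a set| \<le>o cardSuc natLeq"
  obtains E :: "'a \<Rightarrow> nat \<Rightarrow> 'a" where "\<And>x y. x \<in> range (E y) \<or> y \<in> range (E x)"
proof -
  define r where "r = |UNIV :: 'a set|"
  have r: "Card_order r" "Field r = UNIV"
    unfolding r_def by (rule card_of_Card_order Field_card_of)+
  have "|underS r x| <o cardSuc natLeq" for x
    using card_of_underS[OF r(1), of x] assms r(2)
    by (auto simp: r_def intro: ordLess_ordLeq_trans)
  then have "countable (underS r x)" for x
    unfolding countable_card_le_natLeq
    by (simp add: cardSuc_ordLeq_ordLess natLeq_Card_order card_of_Card_order)
  then have range: "range (from_nat_into (insert x (underS r x))) = insert x (underS r x)" for x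
    by (intro range_from_nat_into) simp_all
  have "Total r"
    using r(1) by (simp add: card_order_on_def well_order_on_def linear_order_on_def)
  then have "x \<in> insert y (underS r y) \<or> y \<in> insert x (underS r x)" for x y
    using r(2) by (auto simp: underS_def total_on_def)
  then show thesis
    using that[of "\<lambda>x. from_nat_into (insert x (underS r x))"] by (simp only: range)
qed

lemma ordLeq_cardSuc_natLeq_obtain_sequences:
  assumes "|UNIV :: 'a set| \<le>o cardSuc natLeq"
  obtains F :: "(nat \<Rightarrow> 'a) set"
  where "\<And>x. \<exists>e\<in>F. x \<in> range e" and "\<And>x. countable {e \<in> F. x \<notin> range e}"
proof -
  obtain E :: "'a \<Rightarrow> nat \<Rightarrow> 'a" where E: "\<And>x y. x \<in> range (E y) \<or> y \<in> range (E x)"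
    using ordLeq_cardSuc_natLeq_obtain_enumeration[OF assms] by blast
  show thesis
  proof (rule that[of "range E"])
    fix x
    show "\<exists>e\<in>range E. x \<in> range e"
      using E[of x x] by blast
    have "{e \<in> range E. x \<notin> range e} \<subseteq> E ` range (E x)"
      using E by blast
    then show "countable {e \<in> range E. x \<notin> range e}"
      by (rule countable_subset) simp
  qed
qed

definition encode_seq :: "(nat \<Rightarrow> nat \<Rightarrow> nat) \<Rightarrow> nat \<Rightarrow> nat" where
  "encode_seq e k = (if even k then 0 else 2 * case_prod e (prod_decode (k div 2)))"

lemma encode_seq_comp: "encode_seq e \<circ> encode_seq e' = encode_seq (\<lambda>_ _. 0)"
  by (auto simp: encode_seq_def fun_eq_iff split: prod.split)

lemma decode_encode_seq:
  "(\<lambda>k. k div 2) \<circ> (encode_seq e \<circ> (\<lambda>x. Suc (2 * prod_encode (n, x)))) = e n"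
  by (simp add: encode_seq_def fun_eq_iff)

lemma subsemigroup_encode_seq_image: "(\<lambda>_ _. 0) \<in> F \<Longrightarrow> subsemigroup (encode_seq ` F)"
  by (auto simp: subsemigroup_def encode_seq_comp)

lemma UNIV_gen_le_encode_seq_image:
  assumes "\<And>g. \<exists>e\<in>F. g \<in> range e"
  shows "UNIV \<preceq>\<^sub>\<omega> encode_seq ` F"
proof -
  define C where "C = insert (\<lambda>k. k div 2) (range (\<lambda>n x. Suc (2 * prod_encode (n, x))))"
  have "g \<in> generated (encode_seq ` F) C" for g
  proof -
    obtain e n where "e \<in> F" "g = e n"
      using assms[of g] by blast
    moreover from this have "{encode_seq e, \<lambda>k. k div 2, \<lambda>x. Suc (2 * prod_encode (n, x))}
        \<subseteq> generated (encode_seq ` F) C"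
      using subset_generated[of "encode_seq ` F" C] by (auto simp: C_def)
    ultimately show ?thesis
      using comp_in_generated decode_encode_seq[of e n] by (metis insert_subset)
  qed
  moreover have "countable C"
    by (simp add: C_def)
  ultimately show ?thesis
    unfolding gen_le_def by blast
qed

lemma UNIV_gen_le_uncountable_subset_encode_seq_image:
  assumes missed: "\<And>g. countable {e \<in> F. g \<notin> range e}"
    and T: "T \<subseteq> encode_seq ` F" "uncountable T"
  shows "UNIV \<preceq>\<^sub>\<omega> T"
proof -
  obtain F' where F': "F' \<subseteq> F" "T = encode_seq ` F'"
    using T(1) by (auto simp: subset_image_iff)
  with T(2) have "uncountable F'"
    by auto
  have "\<exists>e\<in>F'. g \<in> range e" for g
  proof (rule ccontr)
    assume "\<not> (\<exists>e\<in>F'. g \<in> range e)"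
    with F'(1) have "F' \<subseteq> {e \<in> F. g \<notin> range e}"
      by blast
    with missed \<open>uncountable F'\<close> show False
      using countable_subset by blast
  qed
  then show ?thesis
    unfolding F'(2) by (rule UNIV_gen_le_encode_seq_image)
qed

theorem theorem2p1:
  "continuum_hypothesis \<longleftrightarrow>
    (\<exists>S :: (nat \<Rightarrow> nat) set. subsemigroup S \<and> S \<approx>\<^sub>\<omega> UNIV \<and>
      (\<forall>T. T \<subseteq> S \<and> subsemigroup T \<longrightarrow> T \<approx>\<^sub>\<omega> UNIV \<or> T \<approx>\<^sub>\<omega> {id}))"
  (is "_ \<longleftrightarrow> (\<exists>S. ?dichotomy S)")
proof
  assume continuum_hypothesis
  then obtain F :: "(nat \<Rightarrow> nat \<Rightarrow> nat) set"
    where covered: "\<And>g. \<exists>e\<in>F. g \<in> range e" and missed: "\<And>g. countable {e \<in> F. g \<notin> range e}"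
    unfolding continuum_hypothesis_iff_card_of_nat_fun
    using ordLeq_cardSuc_natLeq_obtain_sequences by blast
  let ?F\<^sub>0 = "insert (\<lambda>_ _. 0) F"
  have "countable {e \<in> ?F\<^sub>0. g \<notin> range e}" for g
    by (rule countable_subset[OF _ countable_insert[OF missed[of g]]]) blast
  then have "UNIV \<preceq>\<^sub>\<omega> T \<or> countable T" if "T \<subseteq> encode_seq ` ?F\<^sub>0" for T
    using that UNIV_gen_le_uncountable_subset_encode_seq_image by blast
  moreover have "UNIV \<preceq>\<^sub>\<omega> encode_seq ` ?F\<^sub>0"
    using covered by (intro UNIV_gen_le_encode_seq_image) blast
  ultimately have "?dichotomy (encode_seq ` ?F\<^sub>0)"
    unfolding gen_equiv_UNIV_iff gen_equiv_id_iff_countable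
    by (blast intro: subsemigroup_encode_seq_image)
  then show "\<exists>S. ?dichotomy S" ..
next
  assume "\<exists>S. ?dichotomy S"
  then show continuum_hypothesis
    using continuum_hypothesis_if_dichotomy by blast
qed

end
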